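(* Assume A1, A2 and A3 (stated in the context), and let $(x_k)$ be generated from $x_0$ by the relaxed projection Landweber iteration (RPL) (see context) with relaxation parameters $(\theta_k)$. The following statements hold. (a) If $\theta_k\in(0,2)$ for all $k$, $\inf_k\theta_k>0$ and $\sup_k\theta_k<2$, then $(x_k)$ converges to some $\bar x\in B_\rho(x_0)$ with $F(\bar x)=y$. (b) If A2 holds with $\eta<1/2$ and, for every $k$ with $F'(x_k)^*F_0(x_k)\ne0$, $$\theta_k:=(1-\eta)^{-1}\frac{\|F'(x_k)^*F_0(x_k)\|^2}{\|F_0(x_k)\|^2}\cdot\frac{\|F'(x_k)^*F_0(x_k)\|^2}{\|F'(x_k)F'(x_k)^*F_0(x_k)\|^2},$$ then for all such $k$ one has $0<\theta_k\le(1-\eta)^{-1}<2$, iteration (RPL) reduces to the steepest descent method, and $(x_k)$ converges to some $\bar x\in B_\rho(x_0)$ with $F(\bar x)=y$. (c) If A1 holds with $C\le1$, A2 holds with $\eta<1/2$, and, for every $k$ with $F'(x_k)^*F_0(x_k)\neq0$, $$\theta_k:=(1-\eta)^{-1}\frac{\|F'(x_k)^*F_0(x_k)\|^2}{\|F_0(x_k)\|^2},$$ then for all such $k$ one has $0<\theta_k\le(1-\eta)^{-1}<2$, iteration (RPL) reduces to the nonlinear Landweber iteration, and $(x_k)$ converges to some $\bar x\in B_\rho(x_0)$ with $F(\bar x)=y$. (d) If A1 holds with $C\le1$, A2 holds with $\eta<1/2$, and $\theta_k:=(1-\eta)^{-1}$ for all $k$, then iteration (RPL) reduces to the nonlinear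 minimal error method, and $(x_k)$ converges to some $\bar x\in B_\rho(x_0)$ with $F(\bar x)=y$.
   Context: $X,Y$ are real Hilbert spaces, $F:D(F)\subset X\to Y$ is a (nonlinear) operator, $y\in Y$, and $F_0(x):=F(x)-y$. $B_r(z)$ denotes the open ball of radius $r$ centered at $z$ in $X$. Convergence is in norm. A1: $F$ is continuous on $D(F)$, which has nonempty interior; there are constants $C,\rho>0$ and $x_0\in D(F)$ with $B_\rho(x_0)\subset D(F)$ such that the Gateaux derivative $F'(x)$ (a bounded linear operator $X\to Y$) exists for $x\in B_\rho(x_0)$ and $\|F'(x)\|\le C$ there. A2 (tangential cone condition): there is a constant $\eta\in[0,1)$ such that $\|F(\bar x)-F(x)-F'(x)(\bar x-x)\|\le\eta\|F(\bar x)-F(x)\|$ for all $x,\bar x\in B_\rho(x_0)$. A3: there is $x^\star\in B_{\rho/2}(x_0)$ with $F(x^\star)=y$. The relaxed projection Landweber iteration (RPL), exact data: starting at $x_0$, for $k\ge0$, $$x_{k+1}:=x_k-\theta_k\lambda_kF'(x_k)^*F_0(x_k),\qquad \theta_k\in(0,2),$$ where $\lambda_k:=0$ if $F'(x_k)^*F_0(x_k)=0$, and $\lambda_k:=\dfrac{(1-\eta)\|F_0(x_k)\|^2}{\|F'(x_k)^*F_0(x_k)\|^2}$ otherwise. If $F'(x_k)^*F_0(x_k)=0$ the value of $\theta_k$ is irrelevant (the iteration is stationary) and may be any number in $(0,2)$. The three named methods all have the form $x_{k+1}=x_k-\mu_kF'(x_k)^*F_0(x_k)$ (with $x_{k+1}=x_k$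 if $F'(x_k)^*F_0(x_k)=0$), where, for $F'(x_k)^*F_0(x_k)\ne0$: steepest descent: $\mu_k=\dfrac{\|F'(x_k)^*F_0(x_k)\|^2}{\|F'(x_k)F'(x_k)^*F_0(x_k)\|^2}$; nonlinear Landweber: $\mu_k=1$; minimal error: $\mu_k=\dfrac{\|F_0(x_k)\|^2}{\|F'(x_k)^*F_0(x_k)\|^2}$. That (RPL) reduces to such a method means $\theta_k\lambda_k=\mu_k$ for every $k$ with $F'(x_k)^*F_0(x_k)\ne0$. *)

theory Defs
  imports "HOL-Analysis.Analysis"
begin

text \<open>
  Real Hilbert spaces are types of sort \<open>{real_inner, complete_space}\<close>. The operator
  \<open>F : D(F) \<subseteq> X \<rightarrow> Y\<close> is a total function together with a set \<open>D\<close>; its values outside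
  \<open>D\<close> are unconstrained. Its derivative is a map \<open>F' :: 'a \<Rightarrow> 'a \<Rightarrow>\<^sub>L 'b\<close>
  that is only constrained on the ball in \<open>assumption_A1\<close>. \<open>adjoint\<close> is the library's
  choice-based adjoint, which exists and is unique for bounded linear maps on a Hilbert space.
\<close>

definition has_gateaux_derivative ::
  "('a::real_normed_vector \<Rightarrow> 'b::real_normed_vector) \<Rightarrow> ('a \<Rightarrow>\<^sub>L 'b) \<Rightarrow> 'a \<Rightarrow> bool" where
  "has_gateaux_derivative F L x \<longleftrightarrow>
     (\<forall>h. ((\<lambda>t::real. (F (x + t *\<^sub>R h) - F x) /\<^sub>R t) \<longlongrightarrow> blinfun_apply L h) (at 0))"

definition assumption_A1 ::
  "'a set \<Rightarrow> ('a::{real_inner, complete_space} \<Rightarrow> 'b::{real_inner, complete_space}) \<Rightarrow>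
   ('a \<Rightarrow> 'a \<Rightarrow>\<^sub>L 'b) \<Rightarrow> 'a \<Rightarrow> real \<Rightarrow> real \<Rightarrow> bool" where
  "assumption_A1 D F F' x0 \<rho> C \<longleftrightarrow>
     continuous_on D F \<and> interior D \<noteq> {} \<and> C > 0 \<and> \<rho> > 0 \<and> x0 \<in> D \<and> ball x0 \<rho> \<subseteq> D \<and>
     (\<forall>x\<in>ball x0 \<rho>. has_gateaux_derivative F (F' x) x \<and> norm (F' x) \<le> C)"

definition assumption_A2 ::
  "('a::{real_inner, complete_space} \<Rightarrow> 'b::{real_inner, complete_space}) \<Rightarrow>
   ('a \<Rightarrow> 'a \<Rightarrow>\<^sub>L 'b) \<Rightarrow> 'a \<Rightarrow> real \<Rightarrow> real \<Rightarrow> bool" where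
  "assumption_A2 F F' x0 \<rho> \<eta> \<longleftrightarrow>
     0 \<le> \<eta> \<and> \<eta> < 1 \<and>
     (\<forall>x\<in>ball x0 \<rho>. \<forall>z\<in>ball x0 \<rho>.
        norm (F z - F x - blinfun_apply (F' x) (z - x)) \<le> \<eta> * norm (F z - F x))"

definition assumption_A3 ::
  "('a::{real_inner, complete_space} \<Rightarrow> 'b::{real_inner, complete_space}) \<Rightarrow>
   'b \<Rightarrow> 'a \<Rightarrow> real \<Rightarrow> bool" where
  "assumption_A3 F y x0 \<rho> \<longleftrightarrow> (\<exists>xs\<in>ball x0 (\<rho> / 2). F xs = y)"

definition residual :: "('a \<Rightarrow> 'b::real_inner) \<Rightarrow> 'b \<Rightarrow> 'a \<Rightarrow> 'b" where
  "residual F y x = F x - y"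

text \<open>The vector \<open>F'(x)\<^sup>* F\<^sub>0(x)\<close>, with \<open>F\<^sub>0(x) = F(x) - y\<close>.\<close>

definition grad ::
  "('a::real_inner \<Rightarrow> 'b::real_inner) \<Rightarrow> ('a \<Rightarrow> 'a \<Rightarrow>\<^sub>L 'b) \<Rightarrow> 'b \<Rightarrow> 'a \<Rightarrow> 'a" where
  "grad F F' y x = adjoint (blinfun_apply (F' x)) (residual F y x)"

definition rpl_lambda ::
  "('a::real_inner \<Rightarrow> 'b::real_inner) \<Rightarrow> ('a \<Rightarrow> 'a \<Rightarrow>\<^sub>L 'b) \<Rightarrow> 'b \<Rightarrow> real \<Rightarrow> 'a \<Rightarrow> real" where
  "rpl_lambda F F' y \<eta> x =
     (if grad F F' y x = 0 then 0
      else (1 - \<eta>) * (norm (residual F y x))\<^sup>2 / (norm (grad F F' y x))\<^sup>2)"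

text \<open>
  The recursion only; the range of the relaxation parameters is a separate hypothesis, because it
  is sometimes a conclusion.
\<close>

definition rpl_iteration ::
  "('a::real_inner \<Rightarrow> 'b::real_inner) \<Rightarrow> ('a \<Rightarrow> 'a \<Rightarrow>\<^sub>L 'b) \<Rightarrow> 'b \<Rightarrow> real \<Rightarrow>
   (nat \<Rightarrow> real) \<Rightarrow> 'a \<Rightarrow> (nat \<Rightarrow> 'a) \<Rightarrow> bool" where
  "rpl_iteration F F' y \<eta> \<theta> x0 x \<longleftrightarrow>
     x 0 = x0 \<and>
     (\<forall>k. x (Suc k) = x k - (\<theta> k * rpl_lambda F F' y \<eta> (x k)) *\<^sub>R grad F F' y (x k))"

text \<open>Step sizes \<open>\<mu>\<close> of the three methods, relevant where \<open>grad F F' y x \<noteq> 0\<close>.\<close>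

definition steepest_descent_step ::
  "('a::real_inner \<Rightarrow> 'b::real_inner) \<Rightarrow> ('a \<Rightarrow> 'a \<Rightarrow>\<^sub>L 'b) \<Rightarrow> 'b \<Rightarrow> 'a \<Rightarrow> real" where
  "steepest_descent_step F F' y x =
     (norm (grad F F' y x))\<^sup>2 / (norm (blinfun_apply (F' x) (grad F F' y x)))\<^sup>2"

definition landweber_step :: "'a \<Rightarrow> real" where
  "landweber_step x = 1"

definition minimal_error_step ::
  "('a::real_inner \<Rightarrow> 'b::real_inner) \<Rightarrow> ('a \<Rightarrow> 'a \<Rightarrow>\<^sub>L 'b) \<Rightarrow> 'b \<Rightarrow> 'a \<Rightarrow> real" where
  "minimal_error_step F F' y x =
     (norm (residual F y x))\<^sup>2 / (norm (grad F F' y x))\<^sup>2"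

definition rpl_reduces_to ::
  "('a::real_inner \<Rightarrow> 'b::real_inner) \<Rightarrow> ('a \<Rightarrow> 'a \<Rightarrow>\<^sub>L 'b) \<Rightarrow> 'b \<Rightarrow> real \<Rightarrow>
   (nat \<Rightarrow> real) \<Rightarrow> (nat \<Rightarrow> 'a) \<Rightarrow> ('a \<Rightarrow> real) \<Rightarrow> bool" where
  "rpl_reduces_to F F' y \<eta> \<theta> x \<mu> \<longleftrightarrow>
     (\<forall>k. grad F F' y (x k) \<noteq> 0 \<longrightarrow> \<theta> k * rpl_lambda F F' y \<eta> (x k) = \<mu> (x k))"

end

theory Submission
  imports Defs
begin

text \<open>
  Every solution \<open>z\<close> in the ball satisfies \<open>grad x \<bullet> (x - z) \<ge> (1 - \<eta>) |F x - y|\<^sup>2\<close> by the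
  tangential cone condition, so \<open>|x\<^sub>k - z|\<^sup>2\<close> decreases at each step by at least a multiple of
  \<open>\<mu>\<^sub>k |F x\<^sub>k - y|\<^sup>2\<close>, where \<open>\<mu>\<^sub>k = \<theta>\<^sub>k \<lambda>\<^sub>k\<close>, as soon as \<open>\<theta>\<^sub>k\<close> stays away from \<open>2\<close>. Comparing \<open>x\<^sub>j\<close>
  and \<open>x\<^sub>k\<close> with the iterate of smallest residual in between bounds \<open>|x\<^sub>j - x\<^sub>k|\<^sup>2\<close> by a multiple of
  this decrease, so the iterates form a Cauchy sequence. If moreover \<open>\<mu>\<^sub>k\<close> stays away from \<open>0\<close>, the
  residuals tend to \<open>0\<close>. All four parts are instances of this.
\<close>

section \<open>Riesz representation and the adjoint of a bounded operator\<close>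

lemma riesz_representation:
  fixes f :: "'a::{real_inner, complete_space} \<Rightarrow> real"
  assumes "bounded_linear f"
  obtains u where "\<And>h. f h = u \<bullet> h"
proof -
  interpret f: bounded_linear f by fact
  \<comment> \<open>If \<open>u\<close> represents \<open>f\<close>, then \<open>q v\<close> equals
    \<open>(norm (v - u))\<^sup>2 - (norm u)\<^sup>2\<close>. The representing vector is therefore
    sought as a minimiser of \<open>q\<close>.\<close>
  define q where "q v = v \<bullet> v - 2 * f v" for v
  obtain K where K: "\<And>v. norm (f v) \<le> norm v * K"
    using f.bounded by blast
  have q_ge: "q v \<ge> - K\<^sup>2" for v
  proof -
    have "f v \<le> norm v * K"
      using K[of v] by simp
    moreover have "0 \<le> (norm v - K)\<^sup>2"
      by simp
    ultimately show ?thesis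
      by (simp add: q_def power2_diff power2_norm_eq_inner mult.assoc)
  qed
  define I where "I = (INF v. q v)"
  have bdd: "bdd_below (range q)"
    using q_ge by (intro bdd_belowI2)
  have I_le: "I \<le> q v" for v
    unfolding I_def by (rule cINF_lower[OF bdd]) simp
  have "\<exists>v. q v < I + inverse (real (Suc n))" for n
  proof -
    have "(INF v. q v) < I + inverse (real (Suc n))"
      by (simp add: I_def)
    then show ?thesis
      using cINF_less_iff[OF _ bdd] by auto
  qed
  then obtain s where s: "\<And>n. q (s n) < I + inverse (real (Suc n))"
    by metis
  \<comment> \<open>Since the midpoint has \<open>q\<close>-value at least \<open>I\<close>, this
    identity forces two almost minimal points to be close. That makes the minimising sequence
    Cauchy.\<close>
  have parallelogram:
    "(norm (v - w))\<^sup>2 = 2 * q v + 2 * q w - 4 * q ((1/2) *\<^sub>R (v + w))" for v w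
    by (simp add: q_def power2_norm_eq_inner f.scaleR f.add algebra_simps inner_commute)
  have close: "(norm (s m - s n))\<^sup>2 \<le> 2 * inverse (real (Suc m)) + 2 * inverse (real (Suc n))" for m n
    using parallelogram[of "s m" "s n"] s[of m] s[of n] I_le[of "(1/2) *\<^sub>R (s m + s n)"] by linarith
  have "Cauchy s"
  proof (rule metric_CauchyI)
    fix e :: real assume "0 < e"
    then obtain N where N: "inverse (real (Suc N)) < e\<^sup>2 / 4"
      using reals_Archimedean[of "e\<^sup>2 / 4"] by auto
    have "dist (s m) (s n) < e" if "m \<ge> N" "n \<ge> N" for m n
    proof -
      have "inverse (real (Suc m)) \<le> inverse (real (Suc N))"
           "inverse (real (Suc n)) \<le> inverse (real (Suc N))"
        using that by (auto intro!: le_imp_inverse_le)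
      then have "(norm (s m - s n))\<^sup>2 < e\<^sup>2"
        using close[of m n] N by linarith
      then show ?thesis
        using \<open>0 < e\<close> by (simp add: dist_norm power_less_imp_less_base)
    qed
    then show "\<exists>N. \<forall>m\<ge>N. \<forall>n\<ge>N. dist (s m) (s n) < e" by blast
  qed
  then obtain u where u: "s \<longlonglongrightarrow> u"
    using Cauchy_convergent convergent_def by blast
  have "(\<lambda>n. q (s n)) \<longlonglongrightarrow> q u"
    unfolding q_def by (intro tendsto_intros f.tendsto u)
  moreover have "(\<lambda>n. I + inverse (real (Suc n))) \<longlonglongrightarrow> I + 0"
    by (intro tendsto_intros LIMSEQ_inverse_real_of_nat)
  ultimately have "q u \<le> I + 0"
    by (rule LIMSEQ_le) (use s less_imp_le in blast)
  then have q_min: "q u \<le> q v" for v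
    using I_le[of v] by linarith
  have "f h = u \<bullet> h" for h
  proof -
    define d where "d = u \<bullet> h - f h"
    \<comment> \<open>The added 1 keeps \<open>S\<close> positive even for \<open>h = 0\<close>, so
      one choice of \<open>t\<close> below serves all directions.\<close>
    define S where "S = h \<bullet> h + 1"
    have "S > 0" unfolding S_def by (simp add: add_nonneg_pos)
    have "q (u + t *\<^sub>R h) = q u + t\<^sup>2 * (h \<bullet> h) + 2 * t * d" for t
      by (simp add: q_def d_def f.add f.scaleR algebra_simps inner_commute power2_eq_square)
    then have "0 \<le> t\<^sup>2 * (S - 1) + 2 * t * d" for t
      using q_min[of "u + t *\<^sub>R h"] by (simp add: S_def)
    \<comment> \<open>At \<open>t = - d / S\<close> the linear term outweighs the quadratic one, so
      minimality of \<open>u\<close> fails unless \<open>d = 0\<close>.\<close>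
    from this[of "- d / S"] have "0 \<le> S\<^sup>2 * ((- d / S)\<^sup>2 * (S - 1) + 2 * (- d / S) * d)"
      by simp
    also have "\<dots> = - (d\<^sup>2 * (S + 1))"
      using \<open>S > 0\<close> by (simp add: field_simps power2_eq_square)
    finally have "d\<^sup>2 * (S + 1) \<le> 0" by simp
    then have "d = 0"
      using \<open>S > 0\<close> by (simp add: mult_le_0_iff)
    then show ?thesis by (simp add: d_def)
  qed
  then show ?thesis by (rule that)
qed

text \<open>\<open>adjoint\<close> is a choice among maps with this property, so one such map must
  first be exhibited. The Riesz vectors of the functionals
  \<open>v \<mapsto> T v \<bullet> w\<close>, one for each \<open>w\<close>, provide it.\<close>

lemma inner_adjoint_blinfun:
  fixes T :: "'a::{real_inner, complete_space} \<Rightarrow>\<^sub>L 'b::real_inner"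
  shows "blinfun_apply T v \<bullet> w = v \<bullet> adjoint (blinfun_apply T) w"
proof -
  have "\<exists>u. \<forall>v. blinfun_apply T v \<bullet> w = v \<bullet> u" for w
  proof -
    have "bounded_linear (\<lambda>v. blinfun_apply T v \<bullet> w)"
      by (intro bounded_linear_intros)
    then show ?thesis
      by (metis riesz_representation inner_commute)
  qed
  then have "\<exists>T'. \<forall>v w. blinfun_apply T v \<bullet> w = v \<bullet> T' w"
    by metis
  then show ?thesis
    unfolding adjoint_def by (rule someI2_ex) blast
qed

lemma norm_adjoint_blinfun_le:
  fixes T :: "'a::{real_inner, complete_space} \<Rightarrow>\<^sub>L 'b::real_inner"
  shows "norm (adjoint (blinfun_apply T) w) \<le> norm T * norm w"
proof (cases "adjoint (blinfun_apply T) w = 0")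
  case False
  define g where "g = adjoint (blinfun_apply T) w"
  have "norm g * norm g = blinfun_apply T g \<bullet> w"
    by (simp add: inner_adjoint_blinfun g_def flip: power2_norm_eq_inner power2_eq_square)
  also have "\<dots> \<le> norm (blinfun_apply T g) * norm w"
    by (rule norm_cauchy_schwarz)
  also have "\<dots> \<le> norm T * norm g * norm w"
    by (intro mult_right_mono norm_blinfun) auto
  finally have "norm g * norm g \<le> norm g * (norm T * norm w)"
    by (simp add: mult.commute mult.left_commute)
  then show ?thesis
    using False by (simp add: g_def)
qed simp

section \<open>Estimates at a single point from the tangential cone condition\<close>

locale tangential_cone =
  fixes D :: "'a::{real_inner, complete_space} set"
    and F :: "'a \<Rightarrow> 'b::{real_inner, complete_space}"
    and F' :: "'a \<Rightarrow> 'a \<Rightarrow>\<^sub>L 'b"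
    and y :: 'b
    and x0 :: 'a
    and \<rho> C \<eta> :: real
  assumes A1: "assumption_A1 D F F' x0 \<rho> C"
    and A2: "assumption_A2 F F' x0 \<rho> \<eta>"
begin

abbreviation "res \<equiv> residual F y"
abbreviation "gr \<equiv> grad F F' y"
abbreviation "lam \<equiv> rpl_lambda F F' y \<eta>"

lemma C_pos: "C > 0" and eta_nonneg: "0 \<le> \<eta>" and eta_less_1: "\<eta> < 1"
  using A1 A2 by (auto simp: assumption_A1_def assumption_A2_def)

lemma norm_derivative_le: "v \<in> ball x0 \<rho> \<Longrightarrow> norm (F' v) \<le> C"
  using A1 by (auto simp: assumption_A1_def)

lemma cone:
  assumes "v \<in> ball x0 \<rho>" "z \<in> ball x0 \<rho>"
  shows "norm (F z - F v - blinfun_apply (F' v) (z - v)) \<le> \<eta> * norm (F z - F v)"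
  using A2 assms by (auto simp: assumption_A2_def)

lemma norm_derivative_diff_le:
  assumes "v \<in> ball x0 \<rho>" "z \<in> ball x0 \<rho>"
  shows "norm (blinfun_apply (F' v) (z - v)) \<le> (1 + \<eta>) * norm (F z - F v)"
proof -
  have "norm (blinfun_apply (F' v) (z - v))
      \<le> norm (F z - F v) + norm (F z - F v - blinfun_apply (F' v) (z - v))"
    by (metis norm_minus_commute norm_triangle_sub)
  then show ?thesis
    using cone[OF assms] by (simp add: algebra_simps)
qed

lemma inner_grad: "gr v \<bullet> h = blinfun_apply (F' v) h \<bullet> res v"
  by (simp add: grad_def inner_adjoint_blinfun inner_commute)

lemma norm_grad_le: "v \<in> ball x0 \<rho> \<Longrightarrow> norm (gr v) \<le> C * norm (res v)"
  unfolding grad_def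
  by (rule order_trans[OF norm_adjoint_blinfun_le mult_right_mono]) (auto intro: norm_derivative_le)

text \<open>The left side is the pairing of \<open>F' v (gr v)\<close> with \<open>res v\<close>, so
  Cauchy-Schwarz applies. For steepest descent this yields both the nonzero denominators and the
  upper bound on the relaxation parameter.\<close>

lemma norm_grad_sq_le: "(norm (gr v))\<^sup>2 \<le> norm (blinfun_apply (F' v) (gr v)) * norm (res v)"
  by (metis inner_grad norm_cauchy_schwarz power2_norm_eq_inner)

lemma residual_nonzero: "gr v \<noteq> 0 \<Longrightarrow> res v \<noteq> 0"
  using norm_grad_sq_le[of v] by auto

text \<open>As \<open>F z = y\<close>, the cone condition places \<open>F' v (v - z)\<close> within
  \<open>\<eta> * norm (res v)\<close> of \<open>res v\<close>; pairing with \<open>res v\<close>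
  loses at most a fraction \<open>\<eta>\<close>. Geometrically, all solutions in the ball lie in
  one half-space, and if \<open>gr v\<close> is nonzero, the step with relaxation parameter 1
  projects \<open>v\<close> onto its boundary.\<close>

lemma inner_grad_ge:
  assumes "v \<in> ball x0 \<rho>" "z \<in> ball x0 \<rho>" "F z = y"
  shows "(1 - \<eta>) * (norm (res v))\<^sup>2 \<le> gr v \<bullet> (v - z)"
proof -
  let ?r = "res v" and ?e = "F z - F v - blinfun_apply (F' v) (z - v)"
  have "norm ?e \<le> \<eta> * norm ?r"
    using cone[OF assms(1,2)] assms(3) by (simp add: residual_def norm_minus_commute)
  then have "norm ?e * norm ?r \<le> \<eta> * (norm ?r)\<^sup>2"
    by (simp add: power2_eq_square mult_right_mono flip: mult.assoc)
  moreover have "- ?e \<bullet> ?r \<le> norm ?e * norm ?r"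
    using norm_cauchy_schwarz[of "- ?e" ?r] by (simp only: norm_minus_cancel)
  moreover have "- ?e = ?r - blinfun_apply (F' v) (v - z)"
    using assms(3) by (simp add: residual_def blinfun.diff_right)
  ultimately have "(?r - blinfun_apply (F' v) (v - z)) \<bullet> ?r \<le> \<eta> * (norm ?r)\<^sup>2"
    by simp
  then show ?thesis
    by (simp only: inner_grad inner_diff_left power2_norm_eq_inner left_diff_distrib mult_1)
qed

lemma lambda_mult: "lam v * (norm (gr v))\<^sup>2 = (if gr v = 0 then 0 else (1 - \<eta>) * (norm (res v))\<^sup>2)"
  by (simp add: rpl_lambda_def)

lemma lambda_nonneg: "lam v \<ge> 0"
  using eta_less_1 by (simp add: rpl_lambda_def)

text \<open>Used to turn a lower bound on the relaxation parameters into a lower bound on the actual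
  step sizes.\<close>

lemma lambda_ge:
  assumes "v \<in> ball x0 \<rho>" "gr v \<noteq> 0"
  shows "(1 - \<eta>) / C\<^sup>2 \<le> lam v"
proof -
  have "(norm (gr v))\<^sup>2 \<le> C\<^sup>2 * (norm (res v))\<^sup>2"
    using norm_grad_le[OF assms(1)] by (metis norm_ge_zero power_mono power_mult_distrib)
  then have "(1 - \<eta>) * (norm (gr v))\<^sup>2 \<le> (1 - \<eta>) * (C\<^sup>2 * (norm (res v))\<^sup>2)"
    using eta_less_1 by (intro mult_left_mono) auto
  then show ?thesis
    using assms(2) C_pos by (simp add: rpl_lambda_def field_simps)
qed

text \<open>In the expanded square the linear term gains \<open>2 * m * (1 - \<eta>) * R\<close> by
  \<open>inner_grad_ge\<close>, while the choice of \<open>lam\<close> makes the quadratic term cost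
  at most \<open>b * m * (1 - \<eta>) * R\<close>. Where \<open>gr v = 0\<close> the step is zero,
  so \<open>t\<close> needs no bounds there.\<close>

lemma descent:
  assumes v: "v \<in> ball x0 \<rho>" and z: "z \<in> ball x0 \<rho>" "F z = y"
    and t: "gr v \<noteq> 0 \<Longrightarrow> 0 < t \<and> t \<le> b"
  shows "(norm (v - (t * lam v) *\<^sub>R gr v - z))\<^sup>2 + (2 - b) * (1 - \<eta>) * (t * lam v * (norm (res v))\<^sup>2)
    \<le> (norm (v - z))\<^sup>2"
proof (cases "gr v = 0")
  case True
  then show ?thesis by (simp add: rpl_lambda_def)
next
  case False
  define m where "m = t * lam v"
  define R where "R = (norm (res v))\<^sup>2"
  have m: "0 \<le> m" using t[OF False] lambda_nonneg[of v] by (simp add: m_def)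
  have "(norm (v - m *\<^sub>R gr v - z))\<^sup>2 = (norm (v - z))\<^sup>2 - 2 * m * (gr v \<bullet> (v - z)) + m * (m * (norm (gr v))\<^sup>2)"
    by (simp add: power2_norm_eq_inner algebra_simps inner_commute)
  also have "m * (norm (gr v))\<^sup>2 = t * (1 - \<eta>) * R"
    using lambda_mult[of v] False by (simp add: m_def R_def)
  also have "m * (t * (1 - \<eta>) * R) \<le> m * (b * (1 - \<eta>) * R)"
    using t[OF False] m eta_less_1 by (intro mult_left_mono mult_right_mono) (auto simp: R_def)
  finally have "(norm (v - m *\<^sub>R gr v - z))\<^sup>2
      \<le> (norm (v - z))\<^sup>2 - 2 * m * (gr v \<bullet> (v - z)) + m * (b * (1 - \<eta>) * R)"
    by simp
  moreover have "m * ((1 - \<eta>) * R) \<le> m * (gr v \<bullet> (v - z))"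
    using inner_grad_ge[OF v z] m by (simp add: R_def mult_left_mono)
  ultimately show ?thesis
    unfolding m_def[symmetric] R_def[symmetric] by (simp add: algebra_simps)
qed

text \<open>The factor 3 comes from the detour through \<open>v\<close>: the leg from
  \<open>v\<close> to \<open>w\<close> changes the residual by at most
  \<open>2 * norm (res v)\<close>, the leg from \<open>v\<close> to \<open>z\<close> by exactly
  \<open>norm (res v)\<close>. The resulting square matches the decrease in
  \<open>descent\<close>.\<close>

lemma inner_grad_solution_le:
  assumes "v \<in> ball x0 \<rho>" "w \<in> ball x0 \<rho>" "z \<in> ball x0 \<rho>" "F z = y"
    and "norm (res w) \<le> norm (res v)"
  shows "\<bar>gr v \<bullet> (w - z)\<bar> \<le> 3 * (1 + \<eta>) * (norm (res v))\<^sup>2"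
proof -
  let ?T = "blinfun_apply (F' v)"
  have "norm (?T (w - v)) \<le> (1 + \<eta>) * norm (res w - res v)"
    using norm_derivative_diff_le[OF assms(1,2)] by (simp add: residual_def)
  also have "\<dots> \<le> (1 + \<eta>) * (2 * norm (res v))"
    using norm_triangle_ineq4[of "res w" "res v"] assms(5) eta_nonneg by (intro mult_left_mono) auto
  finally have *: "norm (?T (w - v)) \<le> (1 + \<eta>) * (2 * norm (res v))" .
  have "?T (w - z) = ?T (w - v) - ?T (z - v)"
    by (simp flip: blinfun.diff_right)
  then have "norm (?T (w - z)) \<le> norm (?T (w - v)) + norm (?T (z - v))"
    by (simp only: norm_triangle_ineq4)
  also have "\<dots> \<le> (1 + \<eta>) * (2 * norm (res v)) + (1 + \<eta>) * norm (res v)"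
    using norm_derivative_diff_le[OF assms(1,3)] assms(4)
    by (intro add_mono *) (simp add: residual_def norm_minus_commute)
  also have "\<dots> = 3 * (1 + \<eta>) * norm (res v)"
    by (simp add: algebra_simps)
  finally have "norm (?T (w - z)) * norm (res v) \<le> 3 * (1 + \<eta>) * norm (res v) * norm (res v)"
    by (rule mult_right_mono) simp
  then show ?thesis
    using Cauchy_Schwarz_ineq2[of "?T (w - z)" "res v"]
    by (simp add: inner_grad power2_eq_square mult.assoc)
qed

end

section \<open>Error decrease along the iteration\<close>

locale rpl_sequence = tangential_cone +
  fixes \<theta> :: "nat \<Rightarrow> real" and x :: "nat \<Rightarrow> 'a" and b :: real and xs :: 'a
  assumes RPL: "rpl_iteration F F' y \<eta> \<theta> x0 x"
    and solution: "xs \<in> ball x0 (\<rho> / 2)" "F xs = y"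
    and b_less_2: "b < 2"
    and theta_bounds: "\<And>k. x k \<in> ball x0 \<rho> \<Longrightarrow> gr (x k) \<noteq> 0 \<Longrightarrow> 0 < \<theta> k \<and> \<theta> k \<le> b"
begin

abbreviation "E k \<equiv> (norm (x k - xs))\<^sup>2"
abbreviation "w k \<equiv> \<theta> k * lam (x k) * (norm (res (x k)))\<^sup>2"
abbreviation "c \<equiv> (2 - b) * (1 - \<eta>)"

lemma x_0: "x 0 = x0" and x_Suc: "x (Suc k) = x k - (\<theta> k * lam (x k)) *\<^sub>R gr (x k)"
  using RPL by (auto simp: rpl_iteration_def)

lemma c_pos: "c > 0"
  using b_less_2 eta_less_1 by simp

lemma solution_in_ball: "xs \<in> ball x0 \<rho>"
  using solution(1) zero_le_dist[of x0 xs] by (simp del: zero_le_dist)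

text \<open>The radius \<open>\<rho> / 2\<close> in A3 enters here: twice the distance from
  \<open>x0\<close> to \<open>xs\<close> stays below \<open>\<rho>\<close>. A closed ball is used so
  that the limit of the iterates cannot leave it.\<close>

lemma cball_subset: "cball xs (dist x0 xs) \<subseteq> ball x0 \<rho>"
proof
  fix v assume "v \<in> cball xs (dist x0 xs)"
  then show "v \<in> ball x0 \<rho>"
    using solution(1) dist_triangle[of x0 v xs] by (simp add: dist_commute)
qed

lemma step_weight_nonneg: "x k \<in> ball x0 \<rho> \<Longrightarrow> 0 \<le> \<theta> k * lam (x k)"
proof (cases "gr (x k) = 0")
  case False
  then show "0 \<le> \<theta> k * lam (x k)" if "x k \<in> ball x0 \<rho>"
    using theta_bounds[OF that] lambda_nonneg by (intro mult_nonneg_nonneg) (auto intro: less_imp_le)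
qed (simp add: rpl_lambda_def)

text \<open>The bounds on \<open>\<theta> k\<close> are assumed only for \<open>x k\<close> in the
  ball, because for Landweber they rest on the derivative bound there. The induction supplies this
  membership: the current iterate is in the ball, so its step cannot increase the distance to
  \<open>xs\<close>.\<close>

lemma iterate_in_cball: "x k \<in> cball xs (dist x0 xs)"
proof (induction k)
  case 0
  then show ?case by (simp add: x_0 dist_commute)
next
  case (Suc k)
  then have k: "x k \<in> ball x0 \<rho>" using cball_subset by blast
  have "E (Suc k) + c * w k \<le> E k"
    unfolding x_Suc by (rule descent[OF k solution_in_ball solution(2)]) (rule theta_bounds[OF k])
  moreover have "0 \<le> c * w k"
    by (intro mult_nonneg_nonneg less_imp_le[OF c_pos] step_weight_nonneg[OF k]) simp
  ultimately have "E (Suc k) \<le> E k"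
    by linarith
  then have "norm (x (Suc k) - xs) \<le> norm (x k - xs)"
    by (rule power2_le_imp_le) simp
  then show ?case
    using Suc by (simp add: dist_norm norm_minus_commute)
qed

lemma iterate_in_ball: "x k \<in> ball x0 \<rho>"
  using iterate_in_cball cball_subset by blast

lemma weight_nonneg: "0 \<le> w k"
  using step_weight_nonneg[OF iterate_in_ball] by simp

lemma energy_descent: "c * w k \<le> E k - E (Suc k)"
  using descent[OF iterate_in_ball[of k] solution_in_ball solution(2) theta_bounds[OF iterate_in_ball[of k]]]
  by (simp add: x_Suc)

lemma sum_weight_le: "m \<le> n \<Longrightarrow> c * (\<Sum>i=m..<n. w i) \<le> E m - E n"
proof (induction n rule: dec_induct)
  case (step n)
  then show ?case
    using energy_descent[of n] by (simp add: algebra_simps)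
qed simp

lemma energy_antimono:
  assumes "m \<le> n"
  shows "E n \<le> E m"
proof -
  have "0 \<le> c * (\<Sum>i=m..<n. w i)"
    by (intro mult_nonneg_nonneg sum_nonneg weight_nonneg less_imp_le[OF c_pos])
  then show ?thesis
    using sum_weight_le[OF assms] by linarith
qed

section \<open>Cauchy property of the iterates\<close>

lemma inner_diff_le:
  assumes "m \<le> n" and l: "\<And>i. i \<in> {m..<n} \<Longrightarrow> norm (res (x l)) \<le> norm (res (x i))"
  shows "2 * \<bar>(x m - x n) \<bullet> (x l - xs)\<bar> \<le> 6 * (1 + \<eta>) / c * (E m - E n)"
proof -
  have "x m - x n = (\<Sum>i=m..<n. (\<theta> i * lam (x i)) *\<^sub>R gr (x i))"
    using sum_Suc_diff'[OF assms(1), of "\<lambda>i. - x i"] by (simp add: x_Suc)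
  then have "\<bar>(x m - x n) \<bullet> (x l - xs)\<bar> = \<bar>\<Sum>i=m..<n. \<theta> i * lam (x i) * (gr (x i) \<bullet> (x l - xs))\<bar>"
    by (simp add: inner_sum_left)
  also have "\<dots> \<le> (\<Sum>i=m..<n. \<bar>\<theta> i * lam (x i) * (gr (x i) \<bullet> (x l - xs))\<bar>)"
    by (rule sum_abs)
  \<comment> \<open>The minimality of the residual at \<open>l\<close> allows
    \<open>inner_grad_solution_le\<close> in every summand, turning the sum into one of weights,
    which the energy drop controls.\<close>
  also have "\<dots> \<le> (\<Sum>i=m..<n. 3 * (1 + \<eta>) * w i)"
  proof (rule sum_mono)
    fix i assume "i \<in> {m..<n}"
    then have "\<bar>gr (x i) \<bullet> (x l - xs)\<bar> \<le> 3 * (1 + \<eta>) * (norm (res (x i)))\<^sup>2"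
      by (intro inner_grad_solution_le iterate_in_ball solution_in_ball solution l)
    from mult_left_mono[OF this step_weight_nonneg[OF iterate_in_ball, of i]]
    show "\<bar>\<theta> i * lam (x i) * (gr (x i) \<bullet> (x l - xs))\<bar> \<le> 3 * (1 + \<eta>) * w i"
      unfolding abs_mult[of "\<theta> i * lam (x i)"] abs_of_nonneg[OF step_weight_nonneg[OF iterate_in_ball]]
      by (simp only: mult.left_commute[of "\<theta> i * lam (x i)"])
  qed
  also have "\<dots> = 3 * (1 + \<eta>) * (\<Sum>i=m..<n. w i)"
    by (simp add: sum_distrib_left)
  also have "\<dots> \<le> 3 * (1 + \<eta>) * ((E m - E n) / c)"
    using sum_weight_le[OF assms(1)] c_pos eta_nonneg
    by (intro mult_left_mono) (simp_all add: pos_le_divide_eq mult.commute)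
  finally have "2 * \<bar>(x m - x n) \<bullet> (x l - xs)\<bar> \<le> 2 * (3 * (1 + \<eta>) * ((E m - E n) / c))"
    by (rule mult_left_mono) simp
  also have "\<dots> = 6 * (1 + \<eta>) / c * (E m - E n)"
    by simp
  finally show ?thesis .
qed

lemma iterate_distance:
  assumes "k \<le> j"
  shows "norm (x j - x k) \<le> 2 * sqrt ((6 * (1 + \<eta>) / c + 1) * (E k - E j))"
proof -
  let ?K = "6 * (1 + \<eta>) / c"
  have K: "?K \<ge> 0" using c_pos eta_nonneg by simp
  define l where "l = arg_min_on (\<lambda>i. norm (res (x i))) {k..j}"
  have "l \<in> {k..j}"
    unfolding l_def using assms by (intro arg_min_if_finite) auto
  then have l: "k \<le> l" "l \<le> j" by auto
  have l_min: "norm (res (x l)) \<le> norm (res (x i))" if "i \<in> {k..j}" for i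
    unfolding l_def using that by (intro arg_min_least) auto
  \<comment> \<open>Law of cosines around \<open>x l\<close>. For \<open>i = j\<close> the
    difference \<open>E j - E l\<close> is nonpositive and is dropped; for \<open>i = k\<close> it
    stays and accounts for the 1 in \<open>?K + 1\<close>.\<close>
  have expand: "(norm (x i - x l))\<^sup>2 = 2 * ((x l - x i) \<bullet> (x l - xs)) + E i - E l" for i
    by (simp add: power2_norm_eq_inner algebra_simps inner_commute)
  have E: "E j \<le> E l" "E l \<le> E k"
    using energy_antimono l by auto
  have "2 * \<bar>(x l - x j) \<bullet> (x l - xs)\<bar> \<le> ?K * (E l - E j)"
    by (rule inner_diff_le[OF l(2)]) (use l l_min in auto)
  then have "(norm (x j - x l))\<^sup>2 \<le> ?K * (E l - E j)"
    using E(1) unfolding expand[of j] by linarith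
  also have "\<dots> \<le> (?K + 1) * (E k - E j)"
    using K E by (intro mult_mono) auto
  finally have 1: "norm (x j - x l) \<le> sqrt ((?K + 1) * (E k - E j))"
    by (rule real_le_rsqrt)
  have "2 * \<bar>(x k - x l) \<bullet> (x l - xs)\<bar> \<le> ?K * (E k - E l)"
    by (rule inner_diff_le[OF l(1)]) (use l l_min in auto)
  moreover have "(x l - x k) \<bullet> (x l - xs) = - ((x k - x l) \<bullet> (x l - xs))"
    by (simp add: inner_diff_left)
  ultimately have "(norm (x k - x l))\<^sup>2 \<le> ?K * (E k - E l) + (E k - E l)"
    unfolding expand[of k] by linarith
  also have "\<dots> = (?K + 1) * (E k - E l)"
    by (simp only: distrib_right mult_1)
  also have "\<dots> \<le> (?K + 1) * (E k - E j)"
    using K E by (intro mult_left_mono) auto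
  finally have 2: "norm (x k - x l) \<le> sqrt ((?K + 1) * (E k - E j))"
    by (rule real_le_rsqrt)
  show ?thesis
    using 1 2 norm_triangle_ineq4[of "x j - x l" "x k - x l"] by simp
qed

lemma Cauchy_iterates: "Cauchy x"
proof -
  have "decseq E"
    unfolding decseq_def using energy_antimono by blast
  then obtain L where L: "E \<longlonglongrightarrow> L" "\<And>k. L \<le> E k"
    using decseq_convergent[of E 0] by auto
  \<comment> \<open>Replacing \<open>E j\<close> by the limit \<open>L\<close> gives a bound on the
    distance to \<open>x k\<close> that is uniform over all later \<open>j\<close>.\<close>
  define g where "g k = 2 * sqrt ((6 * (1 + \<eta>) / c + 1) * (E k - L))" for k
  have "g \<longlonglongrightarrow> 2 * sqrt ((6 * (1 + \<eta>) / c + 1) * (L - L))"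
    unfolding g_def by (intro tendsto_intros L)
  then have g: "g \<longlonglongrightarrow> 0" by simp
  have dist_le: "dist (x j) (x k) \<le> g k" if "k \<le> j" for j k
  proof -
    have "(6 * (1 + \<eta>) / c + 1) * (E k - E j) \<le> (6 * (1 + \<eta>) / c + 1) * (E k - L)"
      using L(2)[of j] c_pos eta_nonneg by (intro mult_left_mono) auto
    then have "sqrt ((6 * (1 + \<eta>) / c + 1) * (E k - E j)) \<le> sqrt ((6 * (1 + \<eta>) / c + 1) * (E k - L))"
      by (rule real_sqrt_le_mono)
    then show ?thesis
      using iterate_distance[OF that] unfolding g_def dist_norm by linarith
  qed
  show ?thesis
    unfolding Cauchy_altdef2
  proof (intro allI impI)
    fix e :: real assume "0 < e"
    then obtain N where "g N < e"
      using order_tendstoD(2)[OF g] by (auto simp: eventually_sequentially)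
    then show "\<exists>N. \<forall>n\<ge>N. dist (x n) (x N) < e"
      using dist_le by (meson le_less_trans)
  qed
qed

section \<open>Vanishing residuals and the limit\<close>

lemma converges_to_solution:
  assumes m: "m > 0" "\<And>k. gr (x k) \<noteq> 0 \<Longrightarrow> m \<le> \<theta> k * lam (x k)"
  shows "\<exists>xbar\<in>ball x0 \<rho>. F xbar = y \<and> x \<longlonglongrightarrow> xbar"
proof -
  obtain xbar where lim: "x \<longlonglongrightarrow> xbar"
    using Cauchy_iterates Cauchy_convergent convergent_def by blast
  have "xbar \<in> cball xs (dist x0 xs)"
    by (rule closed_sequentially[OF closed_cball _ lim]) (use iterate_in_cball in blast)
  then have xbar: "xbar \<in> ball x0 \<rho>"
    using cball_subset by blast
  have bound: "(norm (res (x k)))\<^sup>2 \<le> (E k - E (Suc k)) / (c * m)" for k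
  proof -
    have "m * (norm (res (x k)))\<^sup>2 \<le> w k"
    proof (cases "gr (x k) = 0")
      \<comment> \<open>A stationary iterate already solves the equation: with zero gradient,
        \<open>inner_grad_ge\<close> forces the residual to vanish. Hence the lower bound
        \<open>m\<close> is required only at nonzero gradients.\<close>
      case True
      then have "(1 - \<eta>) * (norm (res (x k)))\<^sup>2 \<le> 0"
        using inner_grad_ge[OF iterate_in_ball[of k] solution_in_ball solution(2)] by simp
      then show ?thesis
        using eta_less_1 by (simp add: mult_le_0_iff)
    qed (auto intro!: mult_right_mono m)
    then have "c * (m * (norm (res (x k)))\<^sup>2) \<le> E k - E (Suc k)"
      using energy_descent[of k] mult_left_mono[of _ "w k" c] c_pos by fastforce
    then show ?thesis
      using c_pos m(1) by (simp add: pos_le_divide_eq mult_ac)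
  qed
  have "E \<longlonglongrightarrow> (norm (xbar - xs))\<^sup>2"
    by (intro tendsto_intros lim)
  then have "(\<lambda>k. (E k - E (Suc k)) / (c * m)) \<longlonglongrightarrow> ((norm (xbar - xs))\<^sup>2 - (norm (xbar - xs))\<^sup>2) / (c * m)"
    by (intro tendsto_intros lim LIMSEQ_Suc[OF lim]) (use mult_pos_pos[OF c_pos m(1)] in linarith)
  then have *: "(\<lambda>k. (E k - E (Suc k)) / (c * m)) \<longlonglongrightarrow> 0"
    by (simp only: diff_self div_0)
  have "(\<lambda>k. (norm (res (x k)))\<^sup>2) \<longlonglongrightarrow> 0"
  proof (rule Lim_null_comparison[OF _ *])
    show "\<forall>\<^sub>F k in sequentially. norm ((norm (res (x k)))\<^sup>2) \<le> (E k - E (Suc k)) / (c * m)"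
      by (intro always_eventually allI) (simp only: real_norm_def abs_power2 bound)
  qed
  then have "(\<lambda>k. sqrt ((norm (res (x k)))\<^sup>2)) \<longlonglongrightarrow> sqrt 0"
    by (rule tendsto_real_sqrt)
  then have res_0: "(\<lambda>k. res (x k)) \<longlonglongrightarrow> 0"
    by (simp add: tendsto_norm_zero_iff)
  have "continuous_on (ball x0 \<rho>) F"
    using A1 by (auto simp: assumption_A1_def intro: continuous_on_subset)
  then have "isCont F xbar"
    using xbar by (simp add: continuous_on_eq_continuous_at)
  then have "(\<lambda>k. res (x k)) \<longlonglongrightarrow> F xbar - y"
    unfolding residual_def by (intro tendsto_intros isCont_tendsto_compose[OF _ lim])
  then have "F xbar = y"
    using res_0 LIMSEQ_unique by fastforce
  then show ?thesis
    using xbar lim by blast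
qed

end

section \<open>The four choices of relaxation parameters\<close>

theorem theorem3p4:
  fixes D :: "'a::{real_inner, complete_space} set"
    and F :: "'a \<Rightarrow> 'b::{real_inner, complete_space}"
    and F' :: "'a \<Rightarrow> 'a \<Rightarrow>\<^sub>L 'b"
    and y :: 'b
    and x0 :: 'a
    and \<rho> C \<eta> :: real
    and \<theta> :: "nat \<Rightarrow> real"
    and x :: "nat \<Rightarrow> 'a"
  assumes A1: "assumption_A1 D F F' x0 \<rho> C"
    and A2: "assumption_A2 F F' x0 \<rho> \<eta>"
    and A3: "assumption_A3 F y x0 \<rho>"
    and RPL: "rpl_iteration F F' y \<eta> \<theta> x0 x"
  shows
    "((\<forall>k. 0 < \<theta> k \<and> \<theta> k < 2) \<and> (INF k. \<theta> k) > 0 \<and> (SUP k. \<theta> k) < 2 \<longrightarrow>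
        (\<exists>xbar\<in>ball x0 \<rho>. F xbar = y \<and> x \<longlonglongrightarrow> xbar))
     \<and>
     (\<eta> < 1/2 \<and>
      (\<forall>k. grad F F' y (x k) = 0 \<longrightarrow> 0 < \<theta> k \<and> \<theta> k < 2) \<and>
      (\<forall>k. grad F F' y (x k) \<noteq> 0 \<longrightarrow>
         \<theta> k = inverse (1 - \<eta>)
           * ((norm (grad F F' y (x k)))\<^sup>2 / (norm (residual F y (x k)))\<^sup>2)
           * ((norm (grad F F' y (x k)))\<^sup>2
                / (norm (blinfun_apply (F' (x k)) (grad F F' y (x k))))\<^sup>2)) \<longrightarrow>
        (\<forall>k. grad F F' y (x k) \<noteq> 0 \<longrightarrow>
           0 < \<theta> k \<and> \<theta> k \<le> inverse (1 - \<eta>) \<and> inverse (1 - \<eta>) < 2) \<and>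
        rpl_reduces_to F F' y \<eta> \<theta> x (steepest_descent_step F F' y) \<and>
        (\<exists>xbar\<in>ball x0 \<rho>. F xbar = y \<and> x \<longlonglongrightarrow> xbar))
     \<and>
     (C \<le> 1 \<and> \<eta> < 1/2 \<and>
      (\<forall>k. grad F F' y (x k) = 0 \<longrightarrow> 0 < \<theta> k \<and> \<theta> k < 2) \<and>
      (\<forall>k. grad F F' y (x k) \<noteq> 0 \<longrightarrow>
         \<theta> k = inverse (1 - \<eta>)
           * ((norm (grad F F' y (x k)))\<^sup>2 / (norm (residual F y (x k)))\<^sup>2)) \<longrightarrow>
        (\<forall>k. grad F F' y (x k) \<noteq> 0 \<longrightarrow>
           0 < \<theta> k \<and> \<theta> k \<le> inverse (1 - \<eta>) \<and> inverse (1 - \<eta>) < 2) \<and>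
        rpl_reduces_to F F' y \<eta> \<theta> x landweber_step \<and>
        (\<exists>xbar\<in>ball x0 \<rho>. F xbar = y \<and> x \<longlonglongrightarrow> xbar))
     \<and>
     (C \<le> 1 \<and> \<eta> < 1/2 \<and> (\<forall>k. \<theta> k = inverse (1 - \<eta>)) \<longrightarrow>
        rpl_reduces_to F F' y \<eta> \<theta> x (minimal_error_step F F' y) \<and>
        (\<exists>xbar\<in>ball x0 \<rho>. F xbar = y \<and> x \<longlonglongrightarrow> xbar))"
proof -
  interpret tangential_cone D F F' y x0 \<rho> C \<eta>
    by unfold_locales (fact A1, fact A2)
  obtain xs where xs: "xs \<in> ball x0 (\<rho> / 2)" "F xs = y"
    using A3 by (auto simp: assumption_A3_def)
  have inv_pos: "inverse (1 - \<eta>) > 0"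
    using eta_less_1 by simp
  have inv_less_2: "inverse (1 - \<eta>) < 2" if "\<eta> < 1/2"
    using that by (simp add: field_simps)
  have rpl: "rpl_sequence D F F' y x0 \<rho> C \<eta> \<theta> x b xs"
    if "b < 2" "\<And>k. x k \<in> ball x0 \<rho> \<Longrightarrow> gr (x k) \<noteq> 0 \<Longrightarrow> 0 < \<theta> k \<and> \<theta> k \<le> b" for b
    using that by unfold_locales (use RPL xs in blast)+
  \<comment> \<open>Common core of (a) and (d), where \<open>\<theta>\<close> has uniform bounds on
    both sides. In (b) and (c) the product \<open>\<theta> k * lam (x k)\<close> is bounded below
    directly instead.\<close>
  have conv: "\<exists>xbar\<in>ball x0 \<rho>. F xbar = y \<and> x \<longlonglongrightarrow> xbar"
    if "0 < a" "b < 2" "\<And>k. a \<le> \<theta> k \<and> \<theta> k \<le> b" for a b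
  proof -
    interpret rpl_sequence D F F' y x0 \<rho> C \<eta> \<theta> x b xs
      by (rule rpl) (use that less_le_trans in blast)+
    show ?thesis
    proof (rule converges_to_solution)
      show "0 < a * ((1 - \<eta>) / C\<^sup>2)"
        using that(1) C_pos eta_less_1 by simp
    next
      fix k assume "gr (x k) \<noteq> 0"
      then show "a * ((1 - \<eta>) / C\<^sup>2) \<le> \<theta> k * lam (x k)"
        using that(1) that(3)[of k] eta_less_1
        by (intro mult_mono lambda_ge iterate_in_ball) auto
    qed
  qed
  show ?thesis
  proof (intro conjI impI; (elim conjE)?)
    assume \<theta>: "\<forall>k. 0 < \<theta> k \<and> \<theta> k < 2" "(INF k. \<theta> k) > 0" "(SUP k. \<theta> k) < 2"
    \<comment> \<open>On the reals, \<open>INF\<close> and \<open>SUP\<close> are known to bound the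
      terms only once the range is bounded. They then serve as \<open>a\<close> and \<open>b\<close>
      in \<open>conv\<close>.\<close>
    have "bdd_below (range \<theta>)" "bdd_above (range \<theta>)"
      using \<theta>(1) by (auto intro!: bdd_belowI[of _ 0] bdd_aboveI[of _ 2] less_imp_le)
    then show "\<exists>xbar\<in>ball x0 \<rho>. F xbar = y \<and> x \<longlonglongrightarrow> xbar"
      using \<theta> by (intro conv) (auto intro: cINF_lower cSUP_upper)
  next
    assume \<eta>: "\<eta> < 1/2"
      and *: "\<forall>k. gr (x k) \<noteq> 0 \<longrightarrow>
         \<theta> k = inverse (1 - \<eta>) * ((norm (gr (x k)))\<^sup>2 / (norm (res (x k)))\<^sup>2)
           * ((norm (gr (x k)))\<^sup>2 / (norm (blinfun_apply (F' (x k)) (gr (x k))))\<^sup>2)"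
    have nz: "blinfun_apply (F' v) (gr v) \<noteq> 0" if "gr v \<noteq> 0" for v
      using norm_grad_sq_le[of v] that by auto
    have bounds: "0 < \<theta> k \<and> \<theta> k \<le> inverse (1 - \<eta>)" if g: "gr (x k) \<noteq> 0" for k
    proof -
      let ?G = "norm (gr (x k))" and ?R = "norm (res (x k))"
      let ?T = "norm (blinfun_apply (F' (x k)) (gr (x k)))"
      have pos: "?G > 0" "?R > 0" "?T > 0"
        using g residual_nonzero nz by auto
      \<comment> \<open>Apart from the factor \<open>inverse (1 - \<eta>)\<close>, the parameter is
        the square of the Cauchy-Schwarz quotient from \<open>norm_grad_sq_le\<close>, hence at most
        1.\<close>
      have \<theta>: "\<theta> k = inverse (1 - \<eta>) * (?G\<^sup>2 / (?T * ?R))\<^sup>2"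
        using *[rule_format, OF g]
        by (simp only: power_divide power_mult_distrib times_divide_times_eq power2_eq_square mult_ac)
      have "?G\<^sup>2 / (?T * ?R) \<le> 1"
        using norm_grad_sq_le[of "x k"] pos by simp
      then have "(?G\<^sup>2 / (?T * ?R))\<^sup>2 \<le> 1"
        using pos by (intro power_le_one) auto
      then have "\<theta> k \<le> inverse (1 - \<eta>) * 1"
        unfolding \<theta> using inv_pos by (intro mult_left_mono) auto
      then show ?thesis
        using pos inv_pos by (simp add: \<theta>)
    qed
    interpret rpl_sequence D F F' y x0 \<rho> C \<eta> \<theta> x "inverse (1 - \<eta>)" xs
      by (rule rpl) (use bounds inv_less_2[OF \<eta>] in auto)
    show "\<forall>k. gr (x k) \<noteq> 0 \<longrightarrow> 0 < \<theta> k \<and> \<theta> k \<le> inverse (1 - \<eta>) \<and> inverse (1 - \<eta>) < 2"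
      using bounds inv_less_2[OF \<eta>] by blast
    have step: "\<theta> k * lam (x k) = steepest_descent_step F F' y (x k)" if "gr (x k) \<noteq> 0" for k
      using * that residual_nonzero[OF that] nz[OF that] eta_less_1
      by (simp add: rpl_lambda_def steepest_descent_step_def field_simps)
    then show "rpl_reduces_to F F' y \<eta> \<theta> x (steepest_descent_step F F' y)"
      by (simp add: rpl_reduces_to_def)
    show "\<exists>xbar\<in>ball x0 \<rho>. F xbar = y \<and> x \<longlonglongrightarrow> xbar"
    proof (rule converges_to_solution)
      \<comment> \<open>The steepest descent step is the squared quotient of
        \<open>norm (gr (x k))\<close> by the norm of its image under the derivative, and the
        derivative has norm at most \<open>C\<close>.\<close>
      show "0 < inverse (C\<^sup>2)"
        using C_pos by simp
    next
      fix k assume g: "gr (x k) \<noteq> 0"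
      have "norm (blinfun_apply (F' (x k)) (gr (x k))) \<le> C * norm (gr (x k))"
        by (rule order_trans[OF norm_blinfun mult_right_mono])
           (auto intro: norm_derivative_le iterate_in_ball)
      then have "(norm (blinfun_apply (F' (x k)) (gr (x k))))\<^sup>2 \<le> C\<^sup>2 * (norm (gr (x k)))\<^sup>2"
        by (metis norm_ge_zero power_mono power_mult_distrib)
      then show "inverse (C\<^sup>2) \<le> \<theta> k * lam (x k)"
        using g nz[OF g] C_pos by (simp add: step steepest_descent_step_def field_simps)
    qed
  next
    assume C: "C \<le> 1" and \<eta>: "\<eta> < 1/2"
      and *: "\<forall>k. gr (x k) \<noteq> 0 \<longrightarrow>
         \<theta> k = inverse (1 - \<eta>) * ((norm (gr (x k)))\<^sup>2 / (norm (res (x k)))\<^sup>2)"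
    \<comment> \<open>With \<open>C \<le> 1\<close> the gradient is no longer than the residual, but
      only inside the ball. The ball premise is discharged by \<open>iterate_in_ball\<close> once
      the locale is interpreted.\<close>
    have bounds: "0 < \<theta> k \<and> \<theta> k \<le> inverse (1 - \<eta>)"
      if k: "x k \<in> ball x0 \<rho>" and g: "gr (x k) \<noteq> 0" for k
    proof -
      have "norm (gr (x k)) \<le> 1 * norm (res (x k))"
        by (rule order_trans[OF norm_grad_le[OF k] mult_right_mono[OF C]]) simp
      then have "(norm (gr (x k)))\<^sup>2 / (norm (res (x k)))\<^sup>2 \<le> 1"
        by (simp add: divide_le_eq_1 power_mono)
      then have "\<theta> k \<le> inverse (1 - \<eta>) * 1"
        unfolding *[rule_format, OF g] by (rule mult_left_mono) (use inv_pos in simp)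
      then show ?thesis
        using * g inv_pos residual_nonzero[OF g] by simp
    qed
    interpret rpl_sequence D F F' y x0 \<rho> C \<eta> \<theta> x "inverse (1 - \<eta>)" xs
      by (rule rpl) (use bounds inv_less_2[OF \<eta>] in auto)
    show "\<forall>k. gr (x k) \<noteq> 0 \<longrightarrow> 0 < \<theta> k \<and> \<theta> k \<le> inverse (1 - \<eta>) \<and> inverse (1 - \<eta>) < 2"
      using bounds iterate_in_ball inv_less_2[OF \<eta>] by blast
    have step: "\<theta> k * lam (x k) = 1" if "gr (x k) \<noteq> 0" for k
      using * that residual_nonzero[OF that] eta_less_1
      by (simp add: rpl_lambda_def field_simps)
    then show "rpl_reduces_to F F' y \<eta> \<theta> x landweber_step"
      by (simp add: rpl_reduces_to_def landweber_step_def)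
    show "\<exists>xbar\<in>ball x0 \<rho>. F xbar = y \<and> x \<longlonglongrightarrow> xbar"
      by (rule converges_to_solution[of 1]) (simp_all add: step)
  next
    assume \<eta>: "\<eta> < 1/2" and *: "\<forall>k. \<theta> k = inverse (1 - \<eta>)"
    then show "rpl_reduces_to F F' y \<eta> \<theta> x (minimal_error_step F F' y)"
      using eta_less_1 by (simp add: rpl_reduces_to_def rpl_lambda_def minimal_error_step_def)
    show "\<exists>xbar\<in>ball x0 \<rho>. F xbar = y \<and> x \<longlonglongrightarrow> xbar"
      by (rule conv[OF inv_pos inv_less_2[OF \<eta>]]) (use * in simp)
  qed
qed

end
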